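(* Let $n,s,k$ be positive integers with $s\leq n$, and suppose that $\mathcal{F}\subseteq 2^{[n]}$ is $(2,s)$-conditionally intersecting. If $s=2k$, then \[ |\mathcal{F}|\leq \binom{n-1}{k-1}+\sum_{i=k+1}^{n}\binom{n}{i}, \] and if $s < n$ also holds, then equality holds if and only if, up to isomorphism (i.e. up to a permutation of $[n]$), \[ \mathcal{F} = \left\{ F\in \binom{[n]}{k} : 1\in F\right\} \cup \{F\in 2^{[n]} : |F|>k\}. \] If $s=2k-1$, then \[ |\mathcal{F}|\leq \sum_{i=k}^{n}\binom{n}{i}, \] and if $s < n$ also holds, then equality holds if and only if $\mathcal{F} = \{F\in 2^{[n]} : |F|\geq k\}$.
   Context: $[n]=\{1,\ldots,n\}$, $2^{[n]}$ is its power set, and $\binom{[n]}{k}$ is the family of all $k$-element subsets of $[n]$. A family $\mathcal{F} \subseteq 2^{[n]}$ is $(2,s)$-conditionally intersecting if, for each $A,B\in\mathcal{F}$ (not required to be distinct), $A \cap B \neq \emptyset$ whenever $|A \cup B| \leq s$. In particular, such a family does not contain the empty set. *)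

theory Defs
  imports Complex_Main "HOL-Combinatorics.Permutations"
begin

text \<open>
  This is the notion ``\<open>(2,s)\<close>-conditionally intersecting''. The sets \<open>A\<close> and \<open>B\<close> may coincide,
  so \<open>A = B = {}\<close> shows that such a family never contains the empty set. The definition is meant
  for families of finite sets, since \<open>card\<close> is \<open>0\<close> on infinite ones.
\<close>

definition conditionally_intersecting :: "nat \<Rightarrow> 'a set set \<Rightarrow> bool" where
  "conditionally_intersecting s \<F> \<longleftrightarrow>
     (\<forall>A\<in>\<F>. \<forall>B\<in>\<F>. card (A \<union> B) \<le> s \<longrightarrow> A \<inter> B \<noteq> {})"

definition isomorphic_families :: "'a set \<Rightarrow> 'a set set \<Rightarrow> 'a set set \<Rightarrow> bool" where
  "isomorphic_families X \<F> \<G> \<longleftrightarrow> (\<exists>\<pi>. \<pi> permutes X \<and> \<F> = (\<lambda>A. \<pi> ` A) ` \<G>)"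

end

theory Submission
  imports Defs "HOL-Combinatorics.Multiset_Permutations"
begin

text \<open>
  If \<open>i < s - i\<close>, the layers of sizes \<open>i\<close> and \<open>s - i\<close> of the family are cross-intersecting. Counting
  disjoint pairs in two ways shows that together they contain at most \<open>n choose (s - i)\<close> sets, and
  if \<open>s < n\<close> this bound is attained only when the lower layer is empty and the upper one is full.
  If \<open>s = 2 * k\<close>, the layer of size \<open>k\<close> remains; it is an intersecting family, so the
  Erdos-Ko-Rado theorem applies to it.

  The bound in the latter is Katona's cycle argument. If it is attained, every cyclic order of the
  ground set has exactly \<open>k\<close> arcs in the family, and for \<open>2 * k < n\<close> these are consecutive. Take
  \<open>insert x T\<close> in the family and \<open>insert y T\<close> not in it. Cyclic orders in which these two sets are
  neighbouring arcs show that every \<open>k\<close>-set containing \<open>x\<close> but not \<open>y\<close> is in the family, and a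
  member avoiding \<open>x\<close> would be disjoint from one of these.
\<close>

section \<open>Cross-intersecting layers\<close>

text \<open>Both sides count the ordered pairs of disjoint sets of sizes \<open>i\<close> and
  \<open>j\<close> in an \<open>n\<close>-set.\<close>

lemma choose_choose_swap:
  fixes n i j :: nat
  assumes "i + j \<le> n"
  shows "(n choose i) * ((n - i) choose j) = (n choose j) * ((n - j) choose i)"
proof -
  have "(n choose (i + j)) * ((i + j) choose i) = (n choose i) * ((n - i) choose j)"
    using choose_mult[of i "i + j" n] assms by simp
  moreover have "(n choose (i + j)) * ((i + j) choose j) = (n choose j) * ((n - j) choose i)"
    using choose_mult[of j "i + j" n] assms by simp
  moreover have "(i + j) choose i = (i + j) choose j"
    using binomial_symmetric[of i "i + j"] by simp
  ultimately show ?thesis by simp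
qed

text \<open>Binomial coefficients increase up to the middle. If \<open>j\<close> lies beyond it,
  reflect to \<open>n - j\<close>, which still exceeds \<open>i\<close> because
  \<open>i + j < n\<close>.\<close>

lemma choose_less_choose:
  fixes n i j :: nat
  assumes "i < j" "i + j < n"
  shows "n choose i < n choose j"
proof (cases "2 * j \<le> n")
  case True
  then show ?thesis using assms by (intro binomial_strict_mono) auto
next
  case False
  then have "n choose i < n choose (n - j)"
    using assms by (intro binomial_strict_mono) auto
  then show ?thesis using assms binomial_symmetric[of j n] by simp
qed

lemma choose_le_choose:
  fixes n i j :: nat
  assumes "i < j" "i + j \<le> n"
  shows "n choose i \<le> n choose j"
proof (cases "i + j = n")
  case True
  then show ?thesis using binomial_symmetric[of i n] by (metis add_diff_cancel_left' le_add1 order_refl)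
next
  case False
  then show ?thesis using assms choose_less_choose[of i j n] by simp
qed

text \<open>Count disjoint pairs of a set in \<G> and a \<open>j\<close>-set outside \<H>. By
  \<open>cross\<close>, every \<open>j\<close>-set disjoint from a member of \<G> lies outside \<H>,
  so the count from \<G> is exact; the count from the other side is an upper bound.\<close>

lemma cross_intersecting_double_count:
  assumes X: "finite X" "card X = n"
    and G: "\<G> \<subseteq> {A. A \<subseteq> X \<and> card A = i}"
    and H: "\<H> \<subseteq> {A. A \<subseteq> X \<and> card A = j}"
    and cross: "\<And>A B. A \<in> \<G> \<Longrightarrow> B \<in> \<H> \<Longrightarrow> A \<inter> B \<noteq> {}"
  shows "card \<G> * ((n - i) choose j) \<le> ((n choose j) - card \<H>) * ((n - j) choose i)"
proof -
  let ?K = "{A. A \<subseteq> X \<and> card A = j} - \<H>"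
  have finK: "finite ?K" and finG: "finite \<G>"
    using X(1) G by (auto intro: finite_subset[of _ "Pow X"])
  have cardK: "card ?K = (n choose j) - card \<H>"
    using X H n_subsets[of X j] by (subst card_Diff_subset) (auto intro: finite_subset[of _ "Pow X"])
  have *: "card {B. B \<subseteq> X - A \<and> card B = m} = (n - card A) choose m" if "A \<subseteq> X" for A m
    using that X n_subsets[of "X - A" m] by (simp add: card_Diff_subset finite_subset)
  have G': "card {B \<in> ?K. A \<inter> B = {}} = (n - i) choose j" if "A \<in> \<G>" for A
  proof -
    have "{B \<in> ?K. A \<inter> B = {}} = {B. B \<subseteq> X - A \<and> card B = j}"
      using cross[OF that] by blast
    then show ?thesis using * that G by auto
  qed
  have K': "card {A \<in> \<G>. A \<inter> B = {}} \<le> (n - j) choose i" if "B \<in> ?K" for B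
  proof -
    have "card {A \<in> \<G>. A \<inter> B = {}} \<le> card {A. A \<subseteq> X - B \<and> card A = i}"
      using G X(1) by (intro card_mono) (auto intro: finite_subset[of _ "Pow X"])
    then show ?thesis using * that by auto
  qed
  have "card \<G> * ((n - i) choose j) = (\<Sum>A\<in>\<G>. card {B \<in> ?K. A \<inter> B = {}})"
    using G' by simp
  also have "\<dots> = (\<Sum>B\<in>?K. card {A \<in> \<G>. A \<inter> B = {}})"
    using finG finK by (intro sum_multicount_gen) auto
  also have "\<dots> \<le> (\<Sum>B\<in>?K. (n - j) choose i)"
    using K' by (rule sum_mono)
  also have "\<dots> = ((n choose j) - card \<H>) * ((n - j) choose i)"
    using cardK by simp
  finally show ?thesis .
qed

lemma cross_intersecting_card_add:
  assumes X: "finite X" "card X = n"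
    and G: "\<G> \<subseteq> {A. A \<subseteq> X \<and> card A = i}"
    and H: "\<H> \<subseteq> {A. A \<subseteq> X \<and> card A = j}"
    and cross: "\<And>A B. A \<in> \<G> \<Longrightarrow> B \<in> \<H> \<Longrightarrow> A \<inter> B \<noteq> {}"
    and ij: "i < j" "i + j \<le> n"
  shows "card \<G> + card \<H> \<le> n choose j"
    and "i + j < n \<Longrightarrow> card \<G> + card \<H> = n choose j \<Longrightarrow> \<G> = {}"
proof -
  let ?d = "(n - i) choose j" and ?e = "(n - j) choose i"
  have finG: "finite \<G>"
    using X(1) G by (auto intro: finite_subset[of _ "Pow X"])
  have count: "card \<G> * ?d \<le> ((n choose j) - card \<H>) * ?e"
    using cross_intersecting_double_count[OF X G H cross] .
  have swap: "(n choose i) * ?d = (n choose j) * ?e"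
    using choose_choose_swap[OF ij(2)] .
  have e: "?e > 0" and ni: "n choose i > 0"
    using ij by (auto intro!: zero_less_binomial)
  \<comment> \<open>By \<open>swap\<close>, \<open>?e\<close> is to \<open>?d\<close> as
    \<open>n choose i\<close> is to \<open>n choose j\<close>, a ratio of at most 1. This lets the
    factors in \<open>count\<close> be cancelled.\<close>
  have "?e \<le> ?d"
  proof (rule ccontr)
    assume "\<not> ?thesis"
    then have "(n choose i) * ?d < (n choose i) * ?e" using ni by simp
    also have "\<dots> \<le> (n choose j) * ?e" using choose_le_choose[OF ij] by simp
    finally show False using swap by simp
  qed
  then have "card \<G> * ?e \<le> card \<G> * ?d" by simp
  then have "card \<G> * ?e \<le> ((n choose j) - card \<H>) * ?e" using count by linarith
  then have le: "card \<G> \<le> (n choose j) - card \<H>" using e by simp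
  have Hle: "card \<H> \<le> n choose j"
    using card_mono[OF _ H] X n_subsets[OF X(1), of j] by simp
  show "card \<G> + card \<H> \<le> n choose j" using le Hle by simp
  assume less: "i + j < n" and eq: "card \<G> + card \<H> = n choose j"
  \<comment> \<open>For \<open>i + j < n\<close> the ratio is strictly below 1. With
    \<open>eq\<close>, \<open>count\<close> bounds \<open>card \<G> * ?d\<close> by
    \<open>card \<G> * ?e\<close>, which leaves only \<open>card \<G> = 0\<close>.\<close>
  have "?e < ?d"
  proof (rule ccontr)
    assume "\<not> ?thesis"
    then have "(n choose i) * ?d \<le> (n choose i) * ?e" by simp
    also have "\<dots> < (n choose j) * ?e" using choose_less_choose[OF ij(1) less] e by simp
    finally show False using swap by simp
  qed
  moreover have "card \<G> * ?d \<le> card \<G> * ?e" using count eq by (metis add_diff_cancel_right')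
  ultimately have "card \<G> = 0" by (metis mult_le_cancel1 not_le neq0_conv)
  then show "\<G> = {}" using finG by simp
qed

section \<open>The Erdos-Ko-Rado theorem with uniqueness\<close>

text \<open>A list stands for a cyclic order. As \<open>rotate\<close> wraps around,
  \<open>i\<close> may be any natural number, and arcs are periodic in it.\<close>

definition arc :: "nat \<Rightarrow> 'a list \<Rightarrow> nat \<Rightarrow> 'a set" where
  "arc k xs i = set (take k (rotate i xs))"

lemma arc_conv_image:
  assumes "k \<le> length xs"
  shows "arc k xs i = (\<lambda>t. xs ! (t mod length xs)) ` {i..<i + k}"
proof -
  have "arc k xs i = (!) (rotate i xs) ` {..<k}"
    unfolding arc_def using assms nth_image[of k "rotate i xs"] by (simp add: lessThan_atLeast0)
  also have "\<dots> = (\<lambda>t. xs ! ((i + t) mod length xs)) ` {..<k}"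
    using assms by (intro image_cong) (auto simp: nth_rotate)
  also have "\<dots> = (\<lambda>t. xs ! (t mod length xs)) ` ((+) i ` {..<k})"
    by (simp add: image_image)
  also have "(+) i ` {..<k} = {i..<i + k}"
    by (simp add: lessThan_atLeast0 add.commute)
  finally show ?thesis .
qed

lemma arc_add_length: "arc k xs (i + length xs) = arc k xs i"
  by (simp add: arc_def flip: rotate_rotate)

text \<open>Any position of the first arc precedes any position of the second by less than a full
  turn, so the two are incongruent modulo the length.\<close>

lemma arc_disjoint:
  assumes "distinct xs" "k \<le> length xs" "i + k \<le> j" "j + k \<le> i + length xs"
  shows "arc k xs i \<inter> arc k xs j = {}"
proof -
  have "xs ! (a mod length xs) \<noteq> xs ! (b mod length xs)"
    if "a \<in> {i..<i + k}" "b \<in> {j..<j + k}" for a b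
  proof
    assume eq: "xs ! (a mod length xs) = xs ! (b mod length xs)"
    have "length xs > 0" using that assms by auto
    then have "a mod length xs = b mod length xs"
      using eq assms(1) by (simp add: nth_eq_iff_index_eq)
    moreover have "a < b" "b < a + length xs" using that assms by auto
    ultimately show False
      by (metis add_diff_inverse_nat leD less_imp_le linorder_not_less mod_eq_dvd_iff_nat
          nat_add_left_cancel_less nat_dvd_not_less zero_less_diff)
  qed
  then show ?thesis using assms(2) by (auto simp: arc_conv_image)
qed

lemma sum_periodic_window:
  fixes g :: "nat \<Rightarrow> nat"
  assumes "\<And>i. g (i + n) = g i"
  shows "sum g {a..<a + n} = sum g {..<n}"
proof (induction a)
  case 0
  then show ?case by (simp add: lessThan_atLeast0)
next
  case (Suc a)
  show ?case
  proof (cases "n = 0")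
    case False
    then have "sum g {a..<a + n} = g a + sum g {Suc a..<a + n}"
      by (simp add: sum.atLeast_Suc_lessThan)
    moreover have "sum g {Suc a..<Suc a + n} = sum g {Suc a..<a + n} + g (a + n)"
      using False by simp
    ultimately show ?thesis using Suc assms by simp
  qed simp
qed

text \<open>This allows the period in which arcs are counted to be placed around a given arc,
  without wrap-around.\<close>

lemma card_periodic_window:
  assumes "\<And>i::nat. P (i + n) \<longleftrightarrow> P i"
  shows "card {i \<in> {a..<a + n}. P i} = card {i \<in> {..<n}. P i}"
proof -
  have *: "card {i \<in> I. P i} = (\<Sum>i\<in>I. if P i then 1 else 0)" if "finite I" for I
    using that by (simp add: sum.inter_filter[symmetric])
  show ?thesis
    unfolding *[OF finite_atLeastLessThan] *[OF finite_lessThan]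
    by (rule sum_periodic_window) (simp add: assms)
qed

lemma card_star:
  assumes "finite X" "x \<in> X" "k > 0"
  shows "card {A. A \<subseteq> X \<and> card A = k \<and> x \<in> A} = (card X - 1) choose (k - 1)"
proof -
  have "{A. A \<subseteq> X \<and> card A = k \<and> x \<in> A} = insert x ` {B. B \<subseteq> X - {x} \<and> card B = k - 1}"
  proof (intro equalityI subsetI)
    fix A assume A: "A \<in> {A. A \<subseteq> X \<and> card A = k \<and> x \<in> A}"
    then have "A = insert x (A - {x})" "A - {x} \<subseteq> X - {x}" "card (A - {x}) = k - 1" by auto
    then show "A \<in> insert x ` {B. B \<subseteq> X - {x} \<and> card B = k - 1}" by blast
  next
    fix A assume "A \<in> insert x ` {B. B \<subseteq> X - {x} \<and> card B = k - 1}"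
    then obtain B where B: "A = insert x B" "B \<subseteq> X - {x}" "card B = k - 1" by auto
    then have "finite B" "x \<notin> B" using assms(1) finite_subset[of B X] by auto
    then show "A \<in> {A. A \<subseteq> X \<and> card A = k \<and> x \<in> A}" using B assms by auto
  qed
  moreover have "inj_on (insert x) {B. B \<subseteq> X - {x} \<and> card B = k - 1}"
    by (intro inj_onI) blast
  ultimately show ?thesis
    using assms n_subsets[of "X - {x}" "k - 1"] by (simp add: card_image)
qed

section \<open>Member arcs of a single cyclic order\<close>

locale intersecting_family =
  fixes X :: "'a set" and n k :: nat and \<F> :: "'a set set"
  assumes fin: "finite X" and card_X: "card X = n"
    and k_pos: "k > 0" and n_ge: "2 * k \<le> n"
    and layer: "\<F> \<subseteq> {A. A \<subseteq> X \<and> card A = k}"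
    and inter: "\<And>A B. A \<in> \<F> \<Longrightarrow> B \<in> \<F> \<Longrightarrow> A \<inter> B \<noteq> {}"
begin

lemma finite_family: "finite \<F>"
  using fin layer by (auto intro: finite_subset[of _ "Pow X"])

definition arcs :: "'a list \<Rightarrow> nat set" where
  "arcs xs = {i \<in> {..<n}. arc k xs i \<in> \<F>}"

lemma length_perm:
  assumes "xs \<in> permutations_of_set X"
  shows "length xs = n" "distinct xs"
  using assms card_X by (auto simp: permutations_of_set_def distinct_card)

lemma no_disjoint_arcs:
  assumes xs: "xs \<in> permutations_of_set X"
    and "i + k \<le> j" "j + k \<le> i + n" "arc k xs i \<in> \<F>"
  shows "arc k xs j \<notin> \<F>"
  using arc_disjoint[of xs k i j] inter[of "arc k xs i" "arc k xs j"] length_perm[OF xs] assms n_ge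
  by auto

text \<open>Within one period, an arc starting outside the window around \<open>i\<close> is
  disjoint from the arc at \<open>i\<close>. Two starts in the window with the same residue modulo
  \<open>k\<close> differ by 0 or \<open>k\<close>, and a difference of \<open>k\<close> makes the
  arcs disjoint. The condition \<open>i \<ge> k\<close> keeps \<open>i + 1 - k\<close> from
  truncating.\<close>

lemma arcs_near:
  assumes xs: "xs \<in> permutations_of_set X"
    and i: "arc k xs i \<in> \<F>" "i \<ge> k"
  defines "S \<equiv> {a \<in> {i + 1 - k..<i + k}. arc k xs a \<in> \<F>}"
  shows "card (arcs xs) = card S" "inj_on (\<lambda>a. a mod k) S"
proof -
  let ?P = "\<lambda>a. arc k xs a \<in> \<F>"
  have "card (arcs xs) = card {a \<in> {i + 1 - k..<(i + 1 - k) + n}. ?P a}"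
    unfolding arcs_def using arc_add_length[of k xs] length_perm[OF xs]
    by (intro card_periodic_window[symmetric]) simp
  also have "{a \<in> {i + 1 - k..<(i + 1 - k) + n}. ?P a} = S"
  proof -
    have "\<not> ?P a" if "i + k \<le> a" "a < (i + 1 - k) + n" for a
      using no_disjoint_arcs[OF xs _ _ i(1), of a] that i(2) by simp
    then show ?thesis unfolding S_def using n_ge k_pos i(2) by (auto simp: not_less) (meson not_le)
  qed
  finally show "card (arcs xs) = card S" .
  have "a = b" if ab: "a \<in> S" "b \<in> S" "a mod k = b mod k" "a \<le> b" for a b
  proof (rule ccontr)
    assume "a \<noteq> b"
    obtain q where q: "b = a + k * q"
      using ab by (metis dvd_def le_add_diff_inverse mod_eq_dvd_iff_nat)
    have "q < 2"
    proof (rule ccontr)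
      assume "\<not> q < 2"
      then have "k * 2 \<le> k * q" by (intro mult_left_mono) auto
      moreover have "b < i + k" "i + 1 - k \<le> a" using ab by (auto simp: S_def)
      ultimately show False using q i(2) by linarith
    qed
    then have "q = 1" using q \<open>a \<noteq> b\<close> by (cases q) auto
    then show False
      using no_disjoint_arcs[OF xs, of a b] ab q n_ge by (auto simp: S_def)
  qed
  then show "inj_on (\<lambda>a. a mod k) S"
    unfolding inj_on_def by (metis nat_le_linear)
qed

lemma card_arcs_le:
  assumes xs: "xs \<in> permutations_of_set X"
  shows "card (arcs xs) \<le> k"
proof (cases "arcs xs = {}")
  case False
  \<comment> \<open>Moving one period on makes the index at least \<open>k\<close>.\<close>
  then obtain i where i: "arc k xs (i + n) \<in> \<F>" "i + n \<ge> k"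
    using arc_add_length[of k xs] length_perm[OF xs] n_ge by (auto simp: arcs_def)
  let ?S = "{a \<in> {i + n + 1 - k..<i + n + k}. arc k xs a \<in> \<F>}"
  have "card ?S = card ((\<lambda>a. a mod k) ` ?S)"
    using arcs_near(2)[OF xs i] by (simp add: card_image)
  also have "\<dots> \<le> card {..<k}"
    using k_pos by (intro card_mono) auto
  finally show ?thesis using arcs_near(1)[OF xs i] by simp
qed simp

text \<open>With \<open>k\<close> member arcs, every residue modulo \<open>k\<close> is attained in
  the window around \<open>i\<close>, and \<open>i - j\<close> and \<open>i + k - j\<close> are the
  only indices there with the residue of \<open>i - j\<close>.\<close>

lemma full_arcs_dichotomy:
  assumes xs: "xs \<in> permutations_of_set X" and full: "card (arcs xs) = k"
    and i: "arc k xs i \<in> \<F>" "i \<ge> k" and j: "1 \<le> j" "j < k"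
  shows "arc k xs (i - j) \<in> \<F> \<or> arc k xs (i + k - j) \<in> \<F>"
proof -
  let ?S = "{a \<in> {i + 1 - k..<i + k}. arc k xs a \<in> \<F>}"
  have "card ((\<lambda>a. a mod k) ` ?S) = k"
    using arcs_near[OF xs i] full by (simp add: card_image)
  then have "(\<lambda>a. a mod k) ` ?S = {..<k}"
    using k_pos by (intro card_subset_eq) auto
  then have "(i - j) mod k \<in> (\<lambda>a. a mod k) ` ?S" using k_pos by auto
  then obtain a where a: "a \<in> ?S" "a mod k = (i - j) mod k" by auto
  have "a = i - j \<or> a = i + k - j"
  proof (cases "a \<le> i - j")
    case True
    then obtain q where q: "i - j = a + k * q"
      using a(2) by (metis dvd_def le_add_diff_inverse mod_eq_dvd_iff_nat)
    moreover have "i + 1 - k \<le> a" using a(1) by simp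
    ultimately have "k * q < k * 1" using i(2) j by linarith
    then have "q = 0" by simp
    then show ?thesis using q by simp
  next
    case False
    then obtain q where q: "a = i - j + k * q"
      using a(2) by (metis dvd_def le_add_diff_inverse mod_eq_dvd_iff_nat nat_le_linear)
    moreover have "a < i + k" using a(1) by simp
    ultimately have "k * q < k * 2" using i(2) j by linarith
    then have "q < 2" by simp
    moreover have "q \<noteq> 0" using False q by (intro notI) simp
    ultimately have "q = 1" by simp
    then show ?thesis using q i j by simp
  qed
  then show ?thesis using a by auto
qed

text \<open>The arcs of a full cyclic order form a run: going backwards from \<open>i\<close>, each arc
  \<open>i - j\<close> is excluded by its disjointness from the arc \<open>i + k - j + 1\<close>, which needs
  \<open>n > 2 * k\<close>; so its partner \<open>i + k - j\<close> is present.\<close>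

lemma full_arcs_run:
  assumes xs: "xs \<in> permutations_of_set X" and full: "card (arcs xs) = k" and n: "2 * k < n"
    and i: "arc k xs i \<in> \<F>" "i \<ge> k" and prev: "arc k xs (i - 1) \<notin> \<F>"
    and j: "1 \<le> j" "j < k"
  shows "arc k xs (i - j) \<notin> \<F> \<and> arc k xs (i + k - j) \<in> \<F>"
  using j
proof (induction j rule: nat_induct_at_least)
  case base
  then show ?case using full_arcs_dichotomy[OF xs full i, of 1] prev by auto
next
  case (Suc j)
  have "i - Suc j + k \<le> i + k - j" "i + k - j + k \<le> i - Suc j + n"
    using Suc n i(2) by linarith+
  then have "arc k xs (i - Suc j) \<notin> \<F>"
    using no_disjoint_arcs[OF xs, of "i - Suc j" "i + k - j"] Suc by auto
  then show ?case using full_arcs_dichotomy[OF xs full i, of "Suc j"] Suc by auto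
qed

lemma full_arcs_run_from_1:
  assumes xs: "xs \<in> permutations_of_set X" and full: "card (arcs xs) = k" and n: "2 * k < n"
    and i: "arc k xs 1 \<in> \<F>" and prev: "arc k xs 0 \<notin> \<F>"
    and l: "1 \<le> l" "l \<le> k"
  shows "arc k xs l \<in> \<F>"
proof (cases "l = 1")
  case False
  have per: "arc k xs (m + n) = arc k xs m" for m
    using arc_add_length[of k xs m] length_perm[OF xs] by simp
  \<comment> \<open>The run is taken from \<open>1 + n\<close> since its start must be at least
    \<open>k\<close>. Going back \<open>k + 1 - l\<close> steps has position \<open>l + n\<close> as
    its partner; \<open>l = 1\<close> was split off because it would need \<open>k\<close>
    steps.\<close>
  have "arc k xs (1 + n + k - (k + 1 - l)) \<in> \<F>"
    using full_arcs_run[OF xs full n, of "1 + n" "k + 1 - l"] per[of 1] per[of 0] assms False n_ge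
    by auto
  moreover have "1 + n + k - (k + 1 - l) = l + n" using l by simp
  ultimately show ?thesis using per[of l] by metis
qed (use i in simp)

section \<open>Counting orderings: the Erdos-Ko-Rado bound\<close>

lemma card_perms_take:
  assumes "A \<subseteq> X" "card A = k"
  shows "card {xs \<in> permutations_of_set X. set (take k xs) = A} = fact k * fact (n - k)"
proof -
  have finA: "finite A" using assms fin finite_subset by blast
  \<comment> \<open>Cutting after \<open>k\<close> entries splits such a list into an ordering of
    \<open>A\<close> and one of its complement.\<close>
  have "bij_betw (\<lambda>(u, v). u @ v) (permutations_of_set A \<times> permutations_of_set (X - A))
          {xs \<in> permutations_of_set X. set (take k xs) = A}"
  proof (rule bij_betw_byWitness[where f' = "\<lambda>xs. (take k xs, drop k xs)"])
    have len: "length u = k" if "u \<in> permutations_of_set A" for u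
      using that assms by (auto simp: permutations_of_set_def distinct_card)
    show "\<forall>p\<in>permutations_of_set A \<times> permutations_of_set (X - A).
        (case case p of (u, v) \<Rightarrow> u @ v of xs \<Rightarrow> (take k xs, drop k xs)) = p"
      using len by auto
    show "\<forall>xs\<in>{xs \<in> permutations_of_set X. set (take k xs) = A}.
        (case (take k xs, drop k xs) of (u, v) \<Rightarrow> u @ v) = xs"
      by simp
    show "(\<lambda>(u, v). u @ v) ` (permutations_of_set A \<times> permutations_of_set (X - A))
        \<subseteq> {xs \<in> permutations_of_set X. set (take k xs) = A}"
      using len assms by (auto simp: permutations_of_set_def)
    show "(\<lambda>xs. (take k xs, drop k xs)) ` {xs \<in> permutations_of_set X. set (take k xs) = A}
        \<subseteq> permutations_of_set A \<times> permutations_of_set (X - A)"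
    proof clarify
      fix xs assume xs: "xs \<in> permutations_of_set X" "A = set (take k xs)"
      have "set (take k xs) \<inter> set (drop k xs) = {}" "set (take k xs) \<union> set (drop k xs) = X"
        using xs length_perm(2)[OF xs(1)] set_take_disj_set_drop_if_distinct[of xs k k]
        by (auto simp: permutations_of_set_def simp flip: set_append)
      then show "take k xs \<in> permutations_of_set (set (take k xs)) \<and>
          drop k xs \<in> permutations_of_set (X - set (take k xs))"
        using length_perm(2)[OF xs(1)] by (auto simp: permutations_of_set_def)
    qed
  qed
  then have "card {xs \<in> permutations_of_set X. set (take k xs) = A} =
      card (permutations_of_set A \<times> permutations_of_set (X - A))"
    by (simp add: bij_betw_same_card)
  then show ?thesis
    using assms finA fin card_X by (simp add: card_cartesian_product card_Diff_subset)
qed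

lemma bij_betw_rotate: "bij_betw (rotate i) (permutations_of_set X) (permutations_of_set X)"
proof (rule bij_betw_imageI)
  show inj: "inj_on (rotate i) (permutations_of_set X)"
  proof (induction i)
    case (Suc i)
    have "inj (rotate1 :: 'a list \<Rightarrow> 'a list)"
      by (metis bij_betw_def bij_rotate1)
    then show ?case
      using comp_inj_on[OF Suc inj_on_subset[OF \<open>inj rotate1\<close> subset_UNIV]]
      by (simp add: rotate_Suc comp_def)
  qed (simp add: inj_on_def)
  show "rotate i ` permutations_of_set X = permutations_of_set X"
    using inj by (intro card_subset_eq) (auto simp: card_image dest: permutations_of_setD
        intro!: permutations_of_setI)
qed

text \<open>Rotation by \<open>i\<close> brings the arc to the front, so the count does not depend
  on \<open>i\<close>.\<close>

lemma card_perms_arc: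
  assumes "A \<subseteq> X" "card A = k"
  shows "card {xs \<in> permutations_of_set X. arc k xs i = A} = fact k * fact (n - k)"
proof -
  have "bij_betw (rotate i) {xs \<in> permutations_of_set X. arc k xs i = A}
      {xs \<in> permutations_of_set X. set (take k xs) = A}"
    unfolding arc_def by (rule bij_betw_Collect[OF bij_betw_rotate]) simp
  then show ?thesis using card_perms_take[OF assms] by (simp add: bij_betw_same_card)
qed

text \<open>Katona's double count of pairs of an ordering and a starting position. Linear orderings
  replace cyclic ones, so each cyclic order occurs \<open>n\<close> times.\<close>

lemma sum_card_arcs:
  "(\<Sum>xs\<in>permutations_of_set X. card (arcs xs)) = n * (card \<F> * (fact k * fact (n - k)))"
proof -
  let ?P = "permutations_of_set X"
  have "(\<Sum>xs\<in>?P. card (arcs xs)) = (\<Sum>i\<in>{..<n}. card {xs \<in> ?P. arc k xs i \<in> \<F>})"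
    unfolding arcs_def using fin by (intro sum_multicount_gen) auto
  also have "\<dots> = (\<Sum>i\<in>{..<n}. card \<F> * (fact k * fact (n - k)))"
  proof (rule sum.cong)
    fix i assume "i \<in> {..<n}"
    have "{xs \<in> ?P. arc k xs i \<in> \<F>} = (\<Union>A\<in>\<F>. {xs \<in> ?P. arc k xs i = A})" by auto
    also have "card \<dots> = (\<Sum>A\<in>\<F>. card {xs \<in> ?P. arc k xs i = A})"
      using fin finite_family by (intro card_UN_disjoint) auto
    also have "\<dots> = (\<Sum>A\<in>\<F>. fact k * fact (n - k))"
      using card_perms_arc layer by (intro sum.cong) auto
    finally show "card {xs \<in> ?P. arc k xs i \<in> \<F>} = card \<F> * (fact k * fact (n - k))" by simp
  qed simp
  finally show ?thesis by simp
qed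

text \<open>The right side is the total number of member arcs if every ordering has \<open>k\<close>
  of them; the left side is the double count for a family of the extremal size.\<close>

lemma choose_pred_identity:
  "n * ((n - 1 choose (k - 1)) * (fact k * fact (n - k))) = fact n * k"
proof -
  have "k * (n choose k) = n * (n - 1 choose (k - 1))"
    using times_binomial_minus1_eq[OF k_pos] by simp
  then have "n * ((n - 1 choose (k - 1)) * (fact k * fact (n - k)))
      = k * (fact k * fact (n - k) * (n choose k))"
    by (metis mult.assoc mult.commute)
  also have "fact k * fact (n - k) * (n choose k) = fact n"
    using n_ge by (intro binomial_fact_lemma) simp
  finally show ?thesis by simp
qed

lemma card_le: "card \<F> \<le> (n - 1) choose (k - 1)"
proof -
  have "n * (card \<F> * (fact k * fact (n - k))) \<le> (\<Sum>xs\<in>permutations_of_set X. k)"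
    unfolding sum_card_arcs[symmetric] by (intro sum_mono card_arcs_le)
  also have "\<dots> = fact n * k" using fin card_X by simp
  also have "\<dots> = n * ((n - 1 choose (k - 1)) * (fact k * fact (n - k)))"
    using choose_pred_identity ..
  finally show ?thesis using k_pos n_ge by simp
qed

section \<open>Equality in the Erdos-Ko-Rado bound\<close>

lemma card_arcs_eq:
  assumes eq: "card \<F> = (n - 1) choose (k - 1)" and xs: "xs \<in> permutations_of_set X"
  shows "card (arcs xs) = k"
proof -
  have "(\<Sum>xs\<in>permutations_of_set X. card (arcs xs)) = (\<Sum>xs\<in>permutations_of_set X. k)"
    using sum_card_arcs eq choose_pred_identity fin card_X by simp
  \<comment> \<open>Each term is at most \<open>k\<close>, so equal sums force equality term by
    term.\<close>
  then show ?thesis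
    by (rule sum_mono_inv) (use xs card_arcs_le in auto)
qed

lemma exchange_pair:
  assumes "A \<in> \<F>" "B \<notin> \<F>" "B \<subseteq> X" "card B = k"
  shows "\<exists>T x y. x \<notin> T \<and> y \<notin> T \<and> x \<noteq> y \<and> y \<in> X \<and> insert x T \<in> \<F> \<and> insert y T \<notin> \<F>"
  using assms(1)
\<comment> \<open>Walk from \<open>A\<close> towards \<open>B\<close> by replacing one element at a
  time. As \<open>B\<close> is not a member, some replacement leaves the family, and the first one
  that does yields \<open>T\<close>, \<open>x\<close> and \<open>y\<close>.\<close>
proof (induction "card (A - B)" arbitrary: A rule: less_induct)
  case less
  have A: "A \<subseteq> X" "card A = k" "finite A" and B: "finite B"
    using less.prems layer assms(3) by (auto intro: finite_subset[OF _ fin])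
  have "A - B \<noteq> {}" "B - A \<noteq> {}"
    using A B assms less.prems card_subset_eq[of B A] card_subset_eq[of A B] by auto
  then obtain a b where ab: "a \<in> A" "a \<notin> B" "b \<in> B" "b \<notin> A" by auto
  show ?case
  proof (cases "insert b (A - {a}) \<in> \<F>")
    case True
    have "insert b (A - {a}) - B \<subset> A - B" using ab by auto
    then have "card (insert b (A - {a}) - B) < card (A - B)"
      using A by (intro psubset_card_mono) auto
    then show ?thesis using less.hyps True by blast
  next
    case False
    then show ?thesis using ab assms(3) less.prems
      by (intro exI[of _ "A - {a}"] exI[of _ a] exI[of _ b]) (auto simp: insert_absorb)
  qed
qed

text \<open>The set \<open>S\<close> is an arc of a cyclic order in which \<open>insert y T\<close> and \<open>insert x T\<close> are
  consecutive, the latter opening the run of arcs that belong to the family.\<close>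

lemma exchange_propagates:
  assumes eq: "card \<F> = (n - 1) choose (k - 1)" and n: "2 * k < n"
    and T: "x \<notin> T" "y \<notin> T" "x \<noteq> y" "y \<in> X" "insert x T \<in> \<F>" "insert y T \<notin> \<F>"
    and S: "S \<subseteq> X" "card S = k" "x \<in> S" "y \<notin> S"
  shows "S \<in> \<F>"
proof -
  have TX: "insert x T \<subseteq> X" "card (insert x T) = k" using T layer by auto
  have fins: "finite T" "finite S" using TX S fin finite_subset by auto
  have cT: "card T + 1 = k" using TX T fins by simp
  obtain us where us: "set us = T - S" "distinct us"
    using finite_distinct_list[of "T - S"] fins by auto
  obtain vs where vs: "set vs = T \<inter> S" "distinct vs"
    using finite_distinct_list[of "T \<inter> S"] fins by auto
  obtain ws where ws: "set ws = S - insert x T" "distinct ws"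
    using finite_distinct_list[of "S - insert x T"] fins by auto
  obtain zs where zs: "set zs = X - insert x (insert y (S \<union> T))" "distinct zs"
    using finite_distinct_list[of "X - insert x (insert y (S \<union> T))"] fin by auto
  \<comment> \<open>The first \<open>k\<close> entries are \<open>y\<close> and \<open>T\<close>.
    One step on, \<open>y\<close> is dropped and \<open>x\<close> gained. Starting after
    \<open>us\<close>, the next \<open>k\<close> entries are \<open>T \<inter> S\<close>,
    \<open>x\<close> and the rest of \<open>S\<close>.\<close>
  let ?xs = "y # us @ vs @ x # ws @ zs"
  have xs: "?xs \<in> permutations_of_set X"
    using us vs ws zs T TX S by (auto simp: permutations_of_set_def)
  have luv: "length us + length vs + 1 = k"
  proof -
    have "length us + length vs = card (T - S) + card (T \<inter> S)"
      using us vs by (metis distinct_card)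
    also have "\<dots> = card T"
      using fins by (metis card_Diff_subset_Int card_mono inf_le1 finite_Int le_add_diff_inverse2)
    finally show ?thesis using cT by simp
  qed
  have lvw: "length vs + 1 + length ws = k"
  proof -
    have "length vs + 1 + length ws = card (set (vs @ x # ws))"
      using vs ws T by (subst distinct_card) auto
    also have "set (vs @ x # ws) = S" using vs ws S by auto
    finally show ?thesis using S by simp
  qed
  have rot: "arc k ?xs (length as) = set (take k (bs @ as))" if "?xs = as @ bs" for as bs
    unfolding arc_def that by (simp add: rotate_append)
  have "arc k ?xs 0 = insert y T"
  proof -
    have "take k ?xs = y # us @ vs"
      using luv by (simp flip: luv)
    then show ?thesis using us vs by (auto simp: arc_def)
  qed
  moreover have "arc k ?xs 1 = insert x T"
  proof -
    have "take k ((us @ vs @ x # ws @ zs) @ [y]) = us @ vs @ [x]"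
      by (simp flip: luv)
    then show ?thesis using rot[of "[y]" "us @ vs @ x # ws @ zs"] us vs by auto
  qed
  moreover have "arc k ?xs (length (y # us)) = S"
  proof -
    have "take k ((vs @ x # ws @ zs) @ y # us) = vs @ x # ws"
      by (simp flip: lvw)
    then show ?thesis using rot[of "y # us" "vs @ x # ws @ zs"] vs ws S by auto
  qed
  \<comment> \<open>The arc \<open>S\<close> starts at \<open>1 + length us\<close>, which is at
    most \<open>k\<close> by \<open>luv\<close>, so it belongs to the run opened at 1.\<close>
  ultimately show ?thesis
    using full_arcs_run_from_1[OF xs card_arcs_eq[OF eq xs] n, of "length (y # us)"] T luv by auto
qed

lemma star_if_card_eq:
  assumes eq: "card \<F> = (n - 1) choose (k - 1)" and n: "2 * k < n"
  shows "\<exists>x\<in>X. \<F> = {A. A \<subseteq> X \<and> card A = k \<and> x \<in> A}"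
proof -
  have "card \<F> > 0" using eq n k_pos by (simp add: zero_less_binomial_iff)
  then obtain A where A: "A \<in> \<F>" by fastforce
  then have cA: "A \<subseteq> X" "card A = k" "finite A"
    using layer by (auto intro: finite_subset[OF _ fin])
  then have "card (X - A) \<ge> k" using n card_X fin by (simp add: card_Diff_subset)
  \<comment> \<open>Being disjoint from the member \<open>A\<close>, this set is a nonmember, which
    the exchange argument needs as its target.\<close>
  then obtain B where B: "B \<subseteq> X - A" "card B = k" by (metis obtain_subset_with_card_n)
  have "B \<notin> \<F>" using inter[OF A, of B] B(1) by blast
  moreover have "B \<subseteq> X" using B(1) by blast
  ultimately obtain T x y where T: "x \<notin> T" "y \<notin> T" "x \<noteq> y" "y \<in> X"
      "insert x T \<in> \<F>" "insert y T \<notin> \<F>"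
    using exchange_pair[OF A _ _ B(2)] by metis
  have x: "x \<in> X" using T layer by auto
  have star: "x \<in> G" if G: "G \<in> \<F>" for G
  proof (rule ccontr)
    assume xG: "x \<notin> G"
    have cG: "G \<subseteq> X" "card G = k" "finite G"
      using G layer by (auto intro: finite_subset[OF _ fin])
    \<comment> \<open>Since \<open>n \<ge> 2 * k + 1\<close>, at least \<open>k - 1\<close> elements
      remain outside, enough for \<open>C\<close>.\<close>
    have "card (insert x (insert y G)) \<le> k + 2"
      using cG by (simp add: card_insert_if)
    moreover have "card (X - insert x (insert y G)) = n - card (insert x (insert y G))"
      using card_X cG x T(4) by (simp add: card_Diff_subset)
    ultimately have "card (X - insert x (insert y G)) \<ge> k - 1"
      using n by linarith
    then obtain C where C: "C \<subseteq> X - insert x (insert y G)" "card C = k - 1"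
      by (metis obtain_subset_with_card_n)
    moreover have "finite C" using C(1) fin by (meson Diff_subset finite_subset)
    moreover have "x \<notin> C" "y \<notin> C" using C(1) by auto
    ultimately have "insert x C \<in> \<F>"
      using x T(3) k_pos by (intro exchange_propagates[OF eq n T]) auto
    then show False using inter[OF G, of "insert x C"] C(1) xG by blast
  qed
  let ?star = "{A. A \<subseteq> X \<and> card A = k \<and> x \<in> A}"
  have "\<F> = ?star"
  proof (rule card_subset_eq)
    show "finite ?star" using fin by (auto intro: finite_subset[of _ "Pow X"])
    show "\<F> \<subseteq> ?star" using star layer by auto
    show "card \<F> = card ?star" using eq card_star[OF fin x k_pos] card_X by simp
  qed
  then show ?thesis using x by blast
qed

end

section \<open>Conditionally intersecting families\<close>

lemma card_conv_layers:
  assumes "finite X" "card X = n" "\<G> \<subseteq> Pow X"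
  shows "card {A \<in> \<G>. P (card A)} = (\<Sum>i | i \<le> n \<and> P i. card {A \<in> \<G>. card A = i})"
proof -
  have fin: "finite \<G>" using finite_subset[OF assms(3)] assms(1) by simp
  have "card A \<le> n" if "A \<in> \<G>" for A
    using card_mono[of X A] that assms by auto
  then have "{A \<in> \<G>. P (card A)} = (\<Union>i\<in>{i. i \<le> n \<and> P i}. {A \<in> \<G>. card A = i})"
    by auto
  also have "card \<dots> = (\<Sum>i | i \<le> n \<and> P i. card {A \<in> \<G>. card A = i})"
    using fin by (intro card_UN_disjoint) auto
  finally show ?thesis .
qed

lemma card_subsets_conv_sum:
  assumes "finite X" "card X = n"
  shows "card {A \<in> Pow X. P (card A)} = (\<Sum>i | i \<le> n \<and> P i. n choose i)"
  using card_conv_layers[OF assms subset_refl, of P] n_subsets[OF assms(1)] assms(2)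
  by (simp add: Pow_def)

lemma sum_mono_inv_le:
  fixes f g :: "'b \<Rightarrow> nat"
  assumes "finite I" "\<And>i. i \<in> I \<Longrightarrow> f i \<le> g i" "sum g I \<le> sum f I" "i \<in> I"
  shows "f i = g i"
proof (rule sum_mono_inv[of f I g])
  show "sum f I = sum g I"
    by (rule antisym[OF sum_mono[OF assms(2)] assms(3)])
qed (use assms in auto)

text \<open>Each layer \<open>j\<close> above \<open>s / 2\<close> is paired with the layer
  \<open>s - j\<close>, and the cross-intersecting bound applies to the pair. Equality in total
  forces equality in every pair, which for \<open>s < n\<close> determines both layers.\<close>

lemma off_middle:
  assumes X: "finite X" "card X = n" and s: "s \<le> n" and F: "\<F> \<subseteq> Pow X"
    and ci: "conditionally_intersecting s \<F>"
  shows "card {A \<in> \<F>. 2 * card A \<noteq> s} \<le> (\<Sum>i | i \<le> n \<and> s < 2 * i. n choose i)"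
    and "s < n \<Longrightarrow> card {A \<in> \<F>. 2 * card A \<noteq> s} = (\<Sum>i | i \<le> n \<and> s < 2 * i. n choose i) \<Longrightarrow>
      {A \<in> \<F>. 2 * card A \<noteq> s} = {A \<in> Pow X. s < 2 * card A}"
proof -
  define L where "L i = {A \<in> \<F>. card A = i}" for i
  \<comment> \<open>For \<open>j > s\<close> there is no partner; the truncated \<open>s - j\<close>
    would be 0 and count the layer of the empty set again.\<close>
  define h where "h j = card (L j) + (if j \<le> s then card (L (s - j)) else 0)" for j
  let ?U = "{j. j \<le> n \<and> s < 2 * j}"
  have finU: "finite ?U" by simp
  have L: "L i \<subseteq> {A. A \<subseteq> X \<and> card A = i}" for i
    using F by (auto simp: L_def)
  have full: "card {A. A \<subseteq> X \<and> card A = i} = n choose i" for i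
    using n_subsets[OF X(1), of i] X(2) by simp
  have finL: "finite (L i)" for i
    using L X(1) by (auto intro: finite_subset[of _ "Pow X"])
  have cross: "A \<inter> B \<noteq> {}" if "A \<in> L (s - j)" "B \<in> L j" "j \<le> s" for A B j
  proof -
    have "card (A \<union> B) \<le> s" using that card_Un_le[of A B] by (simp add: L_def)
    then show ?thesis using ci that by (simp add: conditionally_intersecting_def L_def)
  qed
  have h_le: "h j \<le> n choose j" if j: "j \<in> ?U" for j
  proof (cases "j \<le> s")
    case True
    have "card (L (s - j)) + card (L j) \<le> n choose j"
      using cross True j s by (intro cross_intersecting_card_add(1)[OF X L L]) auto
    then show ?thesis using True by (simp add: h_def)
  next
    case False
    then show ?thesis using card_mono[OF _ L, of j] X(1) full by (simp add: h_def)
  qed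
  have reindex: "(\<Sum>i | i \<le> n \<and> 2 * i < s. card (L i))
      = (\<Sum>j\<in>?U. if j \<le> s then card (L (s - j)) else 0)"
  proof -
    have "(\<Sum>i | i \<le> n \<and> 2 * i < s. card (L i)) = (\<Sum>j | j \<in> ?U \<and> j \<le> s. card (L (s - j)))"
      using s by (intro sum.reindex_bij_witness[of _ "\<lambda>j. s - j" "\<lambda>i. s - i"]) auto
    then show ?thesis using finU by (simp add: sum.inter_filter[symmetric])
  qed
  have "card {A \<in> \<F>. 2 * card A \<noteq> s} = (\<Sum>i | i \<le> n \<and> 2 * i \<noteq> s. card (L i))"
    unfolding L_def using card_conv_layers[OF X F, of "\<lambda>i. 2 * i \<noteq> s"] .
  also have "{i. i \<le> n \<and> 2 * i \<noteq> s} = ?U \<union> {i. i \<le> n \<and> 2 * i < s}" by auto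
  also have "(\<Sum>i\<in>\<dots>. card (L i)) = (\<Sum>i\<in>?U. card (L i)) + (\<Sum>i | i \<le> n \<and> 2 * i < s. card (L i))"
    by (intro sum.union_disjoint) auto
  finally have card_h: "card {A \<in> \<F>. 2 * card A \<noteq> s} = (\<Sum>j\<in>?U. h j)"
    by (simp add: reindex h_def sum.distrib)
  show "card {A \<in> \<F>. 2 * card A \<noteq> s} \<le> (\<Sum>i\<in>?U. n choose i)"
    unfolding card_h using h_le by (rule sum_mono)
  assume less: "s < n" and eq: "card {A \<in> \<F>. 2 * card A \<noteq> s} = (\<Sum>i\<in>?U. n choose i)"
  have h_eq: "h j = n choose j" if "j \<in> ?U" for j
    using sum_mono_inv_le[of ?U h "\<lambda>i. n choose i" j] finU h_le that card_h eq by auto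
  \<comment> \<open>The sizes \<open>s - j\<close> and \<open>j\<close> add up to
    \<open>s < n\<close>, the strict condition of the equality case.\<close>
  have low: "L (s - j) = {}" if j: "j \<in> ?U" "j \<le> s" for j
    using cross j h_eq[OF j(1)] less
    by (intro cross_intersecting_card_add(2)[OF X L L]) (auto simp: h_def)
  have up: "L j = {A. A \<subseteq> X \<and> card A = j}" if j: "j \<in> ?U" for j
  proof -
    have "card (L j) = n choose j" using h_eq[OF j] low[OF j] by (auto simp: h_def split: if_splits)
    then show ?thesis using L X(1) full by (intro card_subset_eq) auto
  qed
  show "{A \<in> \<F>. 2 * card A \<noteq> s} = {A \<in> Pow X. s < 2 * card A}"
  proof (intro equalityI subsetI)
    fix A assume A: "A \<in> {A \<in> \<F>. 2 * card A \<noteq> s}"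
    have "\<not> 2 * card A < s"
    proof
      assume "2 * card A < s"
      \<comment> \<open>The layer of \<open>A\<close> is the partner of
        \<open>j = s - card A\<close>, which lies above \<open>s / 2\<close>.\<close>
      then have "L (s - (s - card A)) = {}" using s by (intro low) auto
      then show False using A \<open>2 * card A < s\<close> by (auto simp: L_def)
    qed
    then show "A \<in> {A \<in> Pow X. s < 2 * card A}" using A F by auto
  next
    fix A assume A: "A \<in> {A \<in> Pow X. s < 2 * card A}"
    then have "A \<in> L (card A)" using X card_mono[of X A] by (subst up) auto
    then show "A \<in> {A \<in> \<F>. 2 * card A \<noteq> s}" using A by (auto simp: L_def)
  qed
qed

lemma card_image_family:
  assumes "\<pi> permutes X"
  shows "card ((\<lambda>A. \<pi> ` A) ` \<G>) = card \<G>"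
  by (intro card_image inj_onI) (simp add: inj_image_eq_iff[OF permutes_inj[OF assms]])

section \<open>Combining the layers for even and odd \<open>s\<close>\<close>

theorem theorem23:
  fixes n s k :: nat and \<F> :: "nat set set"
  assumes "n > 0" and "s > 0" and "k > 0" and "s \<le> n"
    and "\<F> \<subseteq> Pow {1..n}"
    and "conditionally_intersecting s \<F>"
  shows "(s = 2 * k \<longrightarrow>
            card \<F> \<le> ((n - 1) choose (k - 1)) + (\<Sum>i = k + 1..n. n choose i) \<and>
            (s < n \<longrightarrow>
              (card \<F> = ((n - 1) choose (k - 1)) + (\<Sum>i = k + 1..n. n choose i) \<longleftrightarrow>
               isomorphic_families {1..n} \<F>
                 ({F \<in> Pow {1..n}. card F = k \<and> 1 \<in> F} \<union> {F \<in> Pow {1..n}. card F > k})))) \<and>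
         (s = 2 * k - 1 \<longrightarrow>
            card \<F> \<le> (\<Sum>i = k..n. n choose i) \<and>
            (s < n \<longrightarrow>
              (card \<F> = (\<Sum>i = k..n. n choose i) \<longleftrightarrow>
               \<F> = {F \<in> Pow {1..n}. card F \<ge> k})))"
proof -
  let ?X = "{1..n}"
  have X: "finite ?X" "card ?X = n" by simp_all
  have finF: "finite \<F>" using assms(5) finite_subset by blast
  note off = off_middle[OF X assms(4,5,6)]
  have even_case: "card \<F> \<le> ((n - 1) choose (k - 1)) + (\<Sum>i = k + 1..n. n choose i)"
      "s < n \<Longrightarrow> card \<F> = ((n - 1) choose (k - 1)) + (\<Sum>i = k + 1..n. n choose i) \<longleftrightarrow>
        isomorphic_families ?X \<F>
          ({F \<in> Pow ?X. card F = k \<and> 1 \<in> F} \<union> {F \<in> Pow ?X. card F > k})"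
    if s: "s = 2 * k"
  proof -
    let ?M = "{A \<in> \<F>. card A = k}" and ?R = "{A \<in> \<F>. 2 * card A \<noteq> s}"
    let ?star = "\<lambda>x. {A \<in> Pow ?X. card A = k \<and> x \<in> A}" and ?up = "{A \<in> Pow ?X. card A > k}"
    have U: "{i. i \<le> n \<and> s < 2 * i} = {k + 1..n}" using s by auto
    have split: "\<F> = ?M \<union> ?R" "?M \<inter> ?R = {}" using s by auto
    have card_F: "card \<F> = card ?M + card ?R"
      using split finF card_Un_disjoint[of ?M ?R] by simp
    \<comment> \<open>Two \<open>k\<close>-sets have a union of at most \<open>2 * k = s\<close>
      elements, so the middle layer is intersecting.\<close>
    interpret M: intersecting_family ?X n k ?M
    proof
      fix A B assume AB: "A \<in> ?M" "B \<in> ?M"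
      then have "card (A \<union> B) \<le> s" using card_Un_le[of A B] s by simp
      then show "A \<inter> B \<noteq> {}" using AB assms(6) by (simp add: conditionally_intersecting_def)
    qed (use assms s in auto)
    show "card \<F> \<le> ((n - 1) choose (k - 1)) + (\<Sum>i = k + 1..n. n choose i)"
      using card_F M.card_le off(1) unfolding U by linarith
    assume less: "s < n"
    show "card \<F> = ((n - 1) choose (k - 1)) + (\<Sum>i = k + 1..n. n choose i) \<longleftrightarrow>
        isomorphic_families ?X \<F> (?star 1 \<union> ?up)"
    proof
      assume eq: "card \<F> = ((n - 1) choose (k - 1)) + (\<Sum>i = k + 1..n. n choose i)"
      \<comment> \<open>Both summands are bounded separately, so equality in the sum gives equality
        in each.\<close>
      then have M: "card ?M = (n - 1) choose (k - 1)" and R: "card ?R = (\<Sum>i = k + 1..n. n choose i)"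
        using card_F M.card_le off(1) unfolding U by linarith+
      obtain x where x: "x \<in> ?X" "?M = {A. A \<subseteq> ?X \<and> card A = k \<and> x \<in> A}"
        using M.star_if_card_eq[OF M] less s by blast
      have "?R = ?up" using off(2)[OF less] R s unfolding U by simp
      then have F: "\<F> = ?star x \<union> ?up" using split(1) x(2) by auto
      \<comment> \<open>The transposition carries the star of 1 to the star of \<open>x\<close> and
        preserves sizes. It is its own inverse, so each member of \<F> is the image of its own
        image.\<close>
      let ?\<pi> = "transpose 1 x"
      have perm: "?\<pi> permutes ?X" using x(1) assms(1) by (intro permutes_swap_id) auto
      have sub: "?\<pi> ` A \<subseteq> ?X" if "A \<subseteq> ?X" for A
        using that permutes_image[OF perm] by blast
      have cimg: "card (?\<pi> ` A) = card A" for A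
        using permutes_inj_on[OF perm] by (rule card_image)
      have fwd: "?\<pi> ` A \<in> \<F>" if "A \<in> ?star 1 \<union> ?up" for A
        using that sub[of A] cimg[of A] unfolding F by (auto intro: rev_image_eqI)
      have bwd: "?\<pi> ` A \<in> ?star 1 \<union> ?up" if "A \<in> \<F>" for A
        using that sub[of A] cimg[of A] unfolding F by (auto intro: rev_image_eqI)
      have "A \<in> (\<lambda>A. ?\<pi> ` A) ` (?star 1 \<union> ?up)" if "A \<in> \<F>" for A
        using bwd[OF that] by (intro rev_image_eqI[of "?\<pi> ` A"]) (simp_all add: image_image)
      then have "\<F> = (\<lambda>A. ?\<pi> ` A) ` (?star 1 \<union> ?up)" using fwd by blast
      then show "isomorphic_families ?X \<F> (?star 1 \<union> ?up)"
        unfolding isomorphic_families_def using perm by blast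
    next
      assume "isomorphic_families ?X \<F> (?star 1 \<union> ?up)"
      then obtain \<pi> where "\<pi> permutes ?X" "\<F> = (\<lambda>A. \<pi> ` A) ` (?star 1 \<union> ?up)"
        unfolding isomorphic_families_def by blast
      then have "card \<F> = card (?star 1 \<union> ?up)"
        using card_image_family[of \<pi> ?X] by simp
      also have "\<dots> = card (?star 1) + card ?up" by (intro card_Un_disjoint) auto
      also have "card ?up = (\<Sum>i = k + 1..n. n choose i)"
        using card_subsets_conv_sum[OF X, of "\<lambda>i. s < 2 * i"] s unfolding U by simp
      also have "card (?star 1) = (n - 1) choose (k - 1)"
        using card_star[of ?X 1 k] assms by (simp add: Pow_def)
      finally show "card \<F> = ((n - 1) choose (k - 1)) + (\<Sum>i = k + 1..n. n choose i)" .
    qed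
  qed
  have odd_case: "card \<F> \<le> (\<Sum>i = k..n. n choose i)"
      "s < n \<Longrightarrow> card \<F> = (\<Sum>i = k..n. n choose i) \<longleftrightarrow> \<F> = {F \<in> Pow ?X. card F \<ge> k}"
    if s: "s = 2 * k - 1"
  proof -
    have U: "{i. i \<le> n \<and> s < 2 * i} = {k..n}" using s assms(3) by auto
    \<comment> \<open>As \<open>s\<close> is odd, there is no middle layer.\<close>
    have all: "{A \<in> \<F>. 2 * card A \<noteq> s} = \<F>"
    proof -
      have "2 * i \<noteq> s" for i using s assms(3) by presburger
      then show ?thesis by simp
    qed
    have up: "{A \<in> Pow ?X. s < 2 * card A} = {F \<in> Pow ?X. card F \<ge> k}"
      using s assms(3) by auto
    show "card \<F> \<le> (\<Sum>i = k..n. n choose i)"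
      using off(1) unfolding U all .
    show "card \<F> = (\<Sum>i = k..n. n choose i) \<longleftrightarrow> \<F> = {F \<in> Pow ?X. card F \<ge> k}" if "s < n"
      using off(2)[OF that] card_subsets_conv_sum[OF X, of "\<lambda>i. s < 2 * i"] unfolding U all up by auto
  qed
  show ?thesis using even_case odd_case by blast
qed

end
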